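(* Let $n\geq 2$ and $n\geq k\geq 1$ be integers and let $A=(a_{ij})_{1\leq i,j\leq n}\in M_n(\mathbb{R})$ be a $k$-positive (symmetric) matrix. Then $\mathrm{diag}(A)$ is $k$-positive; in other words, $(a_{11},\dots,a_{nn})\in\Gamma_k(n)$. Moreover, $S_k(\mathrm{diag}(A))\geq S_k(A)$.
   Context: $M_n(\mathbb{R})$ is the set of $n\times n$ real matrices. For $\lambda=(\lambda_1,\dots,\lambda_n)\in\mathbb{R}^n$ and $1\le j\le n$, $S_j(\lambda)=\sum_{1\leq i_1<\cdots<i_j\leq n}\lambda_{i_1}\cdots\lambda_{i_j}$ is the $j$-th elementary symmetric function. $\Gamma_k(n)=\{\lambda\in\mathbb{R}^n : S_j(\lambda)>0 \text{ for all } j=1,\dots,k\}$. For a symmetric matrix $A\in M_n(\mathbb{R})$, $\lambda(A)=(\lambda_1,\dots,\lambda_n)$ denotes its eigenvalues (with multiplicity) and $S_k(A):=S_k(\lambda(A))$. A matrix $A\in M_n(\mathbb{R})$ is called $k$-positive if it is symmetric and $\lambda(A)\in\Gamma_k(n)$. For $A=(a_{ij})$, $\mathrm{diag}(A)$ is the diagonal matrix $\mathrm{diag}(a_{11},\dots,a_{nn})$. *)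

theory Defs
  imports Complex_Main "HOL-Library.Multiset" "Jordan_Normal_Form.Char_Poly"
begin

(* The index tuples i_1 < ... < i_j are the j-element subsets of the index set,
   which is 0-based as usual for vectors of type vec. *)
definition elem_sym :: "nat \<Rightarrow> real vec \<Rightarrow> real" where
  "elem_sym j v = (\<Sum>I | I \<subseteq> {0..<dim_vec v} \<and> card I = j. \<Prod>i\<in>I. v $ i)"

definition Gamma_cone :: "nat \<Rightarrow> nat \<Rightarrow> real vec set" where
  "Gamma_cone k n = {v \<in> carrier_vec n. \<forall>j\<in>{1..k}. elem_sym j v > 0}"

(* The eigenvalues are counted as roots of the characteristic polynomial and listed in
   nondecreasing order (any order would do, as elem_sym is invariant under permutations).
   Only real eigenvalues are counted. The vector has dimension n for a symmetric n x n matrix,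
   where algebraic and geometric multiplicity agree. *)
definition eigenvalue_vec :: "real mat \<Rightarrow> real vec" where
  "eigenvalue_vec A = vec_of_list (sorted_list_of_multiset (proots (char_poly A)))"

lemma eigenvalue_iff_in_eigenvalue_vec:
  assumes "A \<in> carrier_mat n n"
  shows "eigenvalue A x \<longleftrightarrow> x \<in> set\<^sub>v (eigenvalue_vec A)"
proof -
  have "char_poly A \<noteq> 0"
    using degree_monic_char_poly[OF assms] by auto
  moreover have "set\<^sub>v (eigenvalue_vec A) = set_mset (proots (char_poly A))"
    unfolding eigenvalue_vec_def set_list_of_vec[symmetric] list_vec
    by (simp flip: set_mset_mset)
  ultimately have "set\<^sub>v (eigenvalue_vec A) = {x. poly (char_poly A) x = 0}"
    by simp
  then show ?thesis
    using eigenvalue_root_char_poly[OF assms] by simp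
qed

definition mat_elem_sym :: "nat \<Rightarrow> real mat \<Rightarrow> real" where
  "mat_elem_sym k A = elem_sym k (eigenvalue_vec A)"

definition k_positive :: "nat \<Rightarrow> nat \<Rightarrow> real mat \<Rightarrow> bool" where
  "k_positive k n A \<longleftrightarrow>
     A \<in> carrier_mat n n \<and> transpose_mat A = A \<and> eigenvalue_vec A \<in> Gamma_cone k n"

definition diag_part :: "real mat \<Rightarrow> real mat" where
  "diag_part A = mat_diag (dim_row A) (\<lambda>i. A $$ (i, i))"

end

theory Submission
  imports Defs "Jordan_Normal_Form.Schur_Decomposition" "Jordan_Normal_Form.Spectral_Radius"
begin

text \<open>
  Write $A$ as the bordered matrix with corner $a = a_{11}$, border $b$ and principal block $C$, and
  let $E_A(t) = \det(1 + tA) = \sum_j S_j(A) t^j$. Both $E_C$ and the correction term in the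
  Schur complement formula $E_A = (1 + a t) E_C - t^2 R$ are values of a quadratic form of the
  resolvent of a symmetric matrix. By the spectral theorem, $E_C$ is a nonnegative combination of the
  polynomials obtained by deleting one eigenvalue of $A$, and $R$ is one of those obtained by deleting
  one eigenvalue of $C$. Deleting an eigenvalue maps $\Gamma_{k+1}$ to $\Gamma_k$, by Newton's
  inequality. Hence $A \in \Gamma_k$ gives $C \in \Gamma_{k-1}$, so the coefficients of $t^2 R$ up
  to degree $k$ are nonnegative: replacing the border of $A$ by zero stays in $\Gamma_k$ and does
  not decrease $S_j$ for $j \le k$. Iterating over the rows turns $A$ into its diagonal.
\<close>

subsection \<open>Real-rooted polynomials\<close>

text \<open>\<open>c = 0\<close> is allowed, so the zero polynomial splits too and the class is
  closed under \<open>pderiv\<close> even at constants.\<close>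

definition splits :: "real poly \<Rightarrow> bool" where
  "splits p \<longleftrightarrow> (\<exists>c M. p = Polynomial.smult c (\<Prod>x\<in>#M. [:-x, 1:]))"

lemma splits_mult:
  assumes "splits p" "splits q"
  shows "splits (p * q)"
proof -
  obtain a M b N where "p = Polynomial.smult a (\<Prod>x\<in>#M. [:-x, 1:])" "q = Polynomial.smult b (\<Prod>x\<in>#N. [:-x, 1:])"
    using assms unfolding splits_def by blast
  then have "p * q = Polynomial.smult (a * b) (\<Prod>x\<in>#M + N. [:-x, 1:])"
    by (simp add: mult_ac)
  then show ?thesis
    unfolding splits_def by blast
qed

lemma splits_linear: "splits [:1, x:]"
proof (cases "x = 0")
  case True
  then have "[:1, x:] = Polynomial.smult 1 (\<Prod>x\<in>#{#}. [:-x, 1:])" by simp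
  then show ?thesis unfolding splits_def by blast
next
  case False
  then have "[:1, x:] = Polynomial.smult x (\<Prod>x\<in>#{#- (1 / x)#}. [:-x, 1:])" by simp
  then show ?thesis unfolding splits_def by blast
qed

text \<open>Laguerre's inequality, by induction on the roots: for \<open>q = (t - x) r\<close> the
  difference \<open>q'^2 - q q''\<close> equals \<open>r^2 + (t - x)^2 (r'^2 - r r'')\<close>. The
  scalar \<open>c\<close> enters only through its square.\<close>

lemma splits_imp_laguerre:
  assumes "splits p"
  shows "poly p s * poly (pderiv (pderiv p)) s \<le> (poly (pderiv p) s)\<^sup>2"
proof -
  obtain c M where p: "p = Polynomial.smult c (\<Prod>x\<in>#M. [:-x, 1:])"
    using assms unfolding splits_def by blast
  have "poly q s * poly (pderiv (pderiv q)) s \<le> (poly (pderiv q) s)\<^sup>2"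
    if "q = (\<Prod>x\<in>#M. [:-x, 1:])" for q
    using that
  proof (induction M arbitrary: q)
    case empty
    then show ?case by simp
  next
    case (add x M)
    define r where "r = (\<Prod>x\<in>#M. [:-x, 1:])"
    have q: "q = [:-x, 1:] * r" using add.prems by (simp add: r_def)
    let ?r = "poly r s" and ?r' = "poly (pderiv r) s" and ?r'' = "poly (pderiv (pderiv r)) s"
    have "(poly (pderiv q) s)\<^sup>2 - poly q s * poly (pderiv (pderiv q)) s
        = ?r\<^sup>2 + (s - x)\<^sup>2 * (?r'\<^sup>2 - ?r * ?r'')"
      unfolding q by (simp add: pderiv_mult pderiv_pCons pderiv_smult pderiv_add pderiv_diff algebra_simps power2_eq_square)
    also have "\<dots> \<ge> 0"
      using add.IH[OF r_def] by (intro add_nonneg_nonneg mult_nonneg_nonneg) auto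
    finally show ?case by simp
  qed
  from mult_left_mono[OF this[OF refl], of "c\<^sup>2"] show ?thesis
    by (simp add: p pderiv_smult power_mult_distrib power2_eq_square mult_ac)
qed

text \<open>The Gauss--Lucas argument: the logarithmic derivative is a sum of terms \<open>1 / (z - x)\<close>, whose
  imaginary parts have the sign opposite to that of \<open>Im z\<close>.\<close>

lemma prod_linear_logderiv_sign:
  fixes M :: "real multiset" and z :: complex
  defines "P \<equiv> (\<Prod>x\<in>#M. [:- of_real x, 1:])"
  assumes z: "Im z \<noteq> 0"
  shows "poly P z \<noteq> 0 \<and> (M \<noteq> {#} \<longrightarrow> Im z * Im (poly (pderiv P) z / poly P z) < 0)"
  unfolding P_def
proof (induction M)
  case empty
  then show ?case by simp
next
  case (add x M)
  define Q :: "complex poly" where "Q = (\<Prod>x\<in>#M. [:- of_real x, 1:])"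
  have zx: "z - of_real x \<noteq> 0" using z by (auto simp: complex_eq_iff)
  have Q0: "poly Q z \<noteq> 0" using add.IH by (simp add: Q_def)
  \<comment> \<open>Only weak, since the logarithmic derivative is 0 when \<open>M\<close> is empty;
    the new factor supplies strictness.\<close>
  have "Im z * Im (poly (pderiv Q) z / poly Q z) \<le> 0"
    using add.IH by (cases "M = {#}") (auto simp: Q_def)
  moreover have "Im z * Im (1 / (z - of_real x)) < 0"
    using z zx by (auto simp: Im_divide power2_eq_square[symmetric] divide_simps complex_eq_iff
        sum_power2_gt_zero_iff add_pos_nonneg add_nonneg_pos)
  moreover have "poly (pderiv ([:- of_real x, 1:] * Q)) z / poly ([:- of_real x, 1:] * Q) z
      = 1 / (z - of_real x) + poly (pderiv Q) z / poly Q z"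
    using zx Q0 by (simp add: pderiv_mult pderiv_pCons pderiv_smult pderiv_diff field_simps)
  ultimately have "Im z * Im (poly (pderiv ([:- of_real x, 1:] * Q)) z / poly ([:- of_real x, 1:] * Q) z) < 0"
    by (simp add: algebra_simps)
  moreover have "poly ([:- of_real x, 1:] * Q) z \<noteq> 0" using zx Q0 by simp
  ultimately show ?case by (simp add: Q_def)
qed

lemma map_poly_of_real_eqD:
  assumes "map_poly complex_of_real p = map_poly of_real q"
  shows "p = q"
  using assms by (intro poly_eqI) (metis coeff_map_poly of_real_0 of_real_eq_iff)

lemma map_poly_of_real_smult:
  "map_poly complex_of_real (Polynomial.smult c p) = Polynomial.smult (of_real c) (map_poly of_real p)"
  by (rule poly_eqI) (simp add: coeff_map_poly)

lemma map_poly_of_real_pderiv: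
  "map_poly complex_of_real (pderiv p) = pderiv (map_poly of_real p)"
  by (rule poly_eqI) (simp add: coeff_map_poly coeff_pderiv)

lemma map_poly_of_real_prod_mset:
  "map_poly complex_of_real (\<Prod>x\<in>#M. [:-x, 1:]) = (\<Prod>x\<in>#M. [:- of_real x, 1:])"
proof (induction M)
  case (add x M)
  have "map_poly complex_of_real ([:-x, 1:] * q) = [:- of_real x, 1:] * map_poly of_real q" for q
    by (rule poly_eqI) (simp add: coeff_map_poly coeff_pCons split: nat.split)
  with add show ?case by simp
qed simp

text \<open>Over the complex numbers the polynomial factors into linear terms; if all roots are
  real, this factorisation is the image of a real one, and \<open>map_poly of_real\<close> is
  injective.\<close>

lemma splits_if_complex_roots_real:
  assumes "\<And>z. poly (map_poly complex_of_real p) z = 0 \<Longrightarrow> Im z = 0"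
  shows "splits p"
proof (cases "p = 0")
  case True
  then have "p = Polynomial.smult 0 (\<Prod>x\<in>#{#}. [:-x, 1:])" by simp
  then show ?thesis unfolding splits_def by blast
next
  case False
  let ?P = "map_poly complex_of_real p"
  have P0: "?P \<noteq> 0" using False by simp
  define M where "M = image_mset Re (proots ?P)"
  have "proots ?P = image_mset complex_of_real M"
    unfolding M_def image_mset.compositionality comp_def
    by (rule sym, rule trans[OF image_mset_cong[of _ _ "\<lambda>z. z"]])
       (use P0 assms in \<open>auto simp: complex_eq_iff\<close>)
  then have "?P = Polynomial.smult (lead_coeff ?P) (\<Prod>x\<in>#M. [:- of_real x, 1:])"
    using complex_poly_decompose_multiset[of ?P] by (simp add: image_mset.compositionality comp_def)
  also have "lead_coeff ?P = of_real (lead_coeff p)"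
    by (simp add: coeff_map_poly)
  also have "Polynomial.smult \<dots> (\<Prod>x\<in>#M. [:- of_real x, 1:])
      = map_poly complex_of_real (Polynomial.smult (lead_coeff p) (\<Prod>x\<in>#M. [:-x, 1:]))"
    by (simp only: map_poly_of_real_smult map_poly_of_real_prod_mset)
  finally have "p = Polynomial.smult (lead_coeff p) (\<Prod>x\<in>#M. [:-x, 1:])"
    by (rule map_poly_of_real_eqD)
  then show ?thesis unfolding splits_def by blast
qed

text \<open>A nonreal root of the derivative would be a zero of the logarithmic derivative, whose
  imaginary part does not vanish there.\<close>

lemma splits_pderiv:
  assumes "splits p"
  shows "splits (pderiv p)"
proof -
  obtain c M where p: "p = Polynomial.smult c (\<Prod>x\<in>#M. [:-x, 1:])"
    using assms unfolding splits_def by blast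
  show ?thesis
  proof (cases "c = 0 \<or> M = {#}")
    case True
    then have "pderiv p = Polynomial.smult 0 (\<Prod>x\<in>#{#}. [:-x, 1:])"
      using p by (auto simp: pderiv_smult)
    then show ?thesis unfolding splits_def by blast
  next
    case False
    show ?thesis
    proof (rule splits_if_complex_roots_real, rule ccontr)
      fix z assume z: "poly (map_poly complex_of_real (pderiv p)) z = 0" "Im z \<noteq> 0"
      have "map_poly complex_of_real (pderiv p) = Polynomial.smult (of_real c) (pderiv (\<Prod>x\<in>#M. [:- of_real x, 1:]))"
        unfolding p pderiv_smult map_poly_of_real_smult map_poly_of_real_pderiv map_poly_of_real_prod_mset ..
      with z(1) False have "poly (pderiv (\<Prod>x\<in>#M. [:- complex_of_real x, 1:])) z = 0"
        by simp
      with prod_linear_logderiv_sign[OF z(2), of M] False show False by simp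
    qed
  qed
qed

text \<open>Laguerre's inequality at 0 is the case \<open>m = 0\<close>; the general case is that
  case for the \<open>m\<close>-th derivative, which still splits.\<close>

lemma splits_newton_weighted:
  assumes "splits p"
  shows "(real m + 2) * (coeff p m * coeff p (m + 2)) \<le> (real m + 1) * (coeff p (m + 1))\<^sup>2"
  using assms
proof (induction m arbitrary: p)
  case 0
  from splits_imp_laguerre[OF 0, of 0] show ?case
    by (simp add: poly_0_coeff_0 coeff_pderiv numeral_2_eq_2 algebra_simps)
next
  case (Suc m)
  from Suc.IH[OF splits_pderiv[OF Suc.prems]]
  \<comment> \<open>Differentiation multiplies the three coefficients by \<open>m + 1\<close>,
    \<open>m + 2\<close> and \<open>m + 3\<close>; the common positive factor
    \<open>(m + 1) (m + 2)\<close> is cancelled next.\<close>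
  have "((real m + 1) * (real m + 2)) * ((real m + 3) * (coeff p (Suc m) * coeff p (m + 3)))
      \<le> ((real m + 1) * (real m + 2)) * ((real m + 2) * (coeff p (m + 2))\<^sup>2)"
    by (simp add: coeff_pderiv power2_eq_square algebra_simps numeral_2_eq_2 numeral_3_eq_3)
  then have "(real m + 3) * (coeff p (Suc m) * coeff p (m + 3)) \<le> (real m + 2) * (coeff p (m + 2))\<^sup>2"
    by (rule mult_left_le_imp_le) auto
  then show ?case by (simp add: numeral_2_eq_2 numeral_3_eq_3 algebra_simps)
qed

lemma splits_newton:
  assumes "splits p"
  shows "coeff p m * coeff p (m + 2) \<le> (coeff p (m + 1))\<^sup>2"
proof (rule ccontr)
  assume *: "\<not> ?thesis"
  have "(real m + 1) * (coeff p (m + 1))\<^sup>2 \<le> (real m + 2) * (coeff p (m + 1))\<^sup>2"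
    by (intro mult_right_mono) auto
  also have "\<dots> < (real m + 2) * (coeff p m * coeff p (m + 2))"
    using * by (intro mult_strict_left_mono) auto
  finally show False using splits_newton_weighted[OF assms, of m] by simp
qed

subsection \<open>Multisets in the cone\<close>

text \<open>Generating function of the elementary symmetric functions: the coefficient of
  \<open>t^j\<close> is \<open>S_j\<close>. For the spectrum of a symmetric \<open>A\<close> it is
  \<open>det (1 + t A)\<close>.\<close>

definition esym_poly :: "real multiset \<Rightarrow> real poly" where
  "esym_poly M = (\<Prod>x\<in>#M. [:1, x:])"

lemma esym_poly_empty [simp]: "esym_poly {#} = 1"
  and esym_poly_add_mset [simp]: "esym_poly (add_mset x M) = [:1, x:] * esym_poly M"
  and esym_poly_union [simp]: "esym_poly (M + N) = esym_poly M * esym_poly N"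
  by (simp_all add: esym_poly_def)

lemma coeff_0_esym_poly [simp]: "coeff (esym_poly M) 0 = 1"
  by (induction M) (simp_all add: coeff_mult)

lemma coeff_Suc_esym_poly_add_mset:
  "coeff (esym_poly (add_mset x M)) (Suc j) = coeff (esym_poly M) (Suc j) + x * coeff (esym_poly M) j"
  by simp

lemma splits_esym_poly: "splits (esym_poly M)"
proof (induction M)
  case empty
  have "1 = Polynomial.smult 1 (\<Prod>x\<in>#{#}. [:-x, 1:])" by simp
  then show ?case unfolding splits_def esym_poly_empty by blast
next
  case (add x M)
  then show ?case unfolding esym_poly_add_mset by (intro splits_mult splits_linear)
qed

text \<open>The cone for multisets of any size, so that entries can be deleted and added freely. At
  \<open>j = 0\<close> the coefficient is \<open>S_0 = 1\<close>.\<close>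

definition Gamma_mset :: "nat \<Rightarrow> real multiset \<Rightarrow> bool" where
  "Gamma_mset k M \<longleftrightarrow> (\<forall>j\<le>k. 0 < coeff (esym_poly M) j)"

text \<open>If \<open>j\<close> were the first index at which positivity of the smaller multiset fails,
  then the assumption at \<open>j\<close> and \<open>j + 1\<close> would contradict Newton's inequality at \<open>j\<close>.\<close>

lemma Gamma_mset_remove:
  assumes "Gamma_mset (Suc k) (add_mset x M)"
  shows "Gamma_mset k M"
proof -
  let ?s = "coeff (esym_poly M)"
  have "0 < ?s j" if "j \<le> k" for j
    using that
  proof (induction j)
    case 0
    then show ?case by simp
  next
    case (Suc j)
    show ?case
    proof (rule ccontr)
      assume neg: "\<not> 0 < ?s (Suc j)"
      have pos: "0 < ?s j" using Suc by simp
      have "0 < coeff (esym_poly (add_mset x M)) i" if "i \<le> Suc k" for i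
        using assms that unfolding Gamma_mset_def by blast
      from this[of "Suc j"] this[of "Suc (Suc j)"] Suc.prems have a: "0 < ?s (Suc j) + x * ?s j" and b: "0 < ?s (Suc (Suc j)) + x * ?s (Suc j)"
        unfolding coeff_Suc_esym_poly_add_mset by linarith+
      have newton: "?s j * ?s (Suc (Suc j)) \<le> (?s (Suc j))\<^sup>2"
        using splits_newton[OF splits_esym_poly, of M j] by simp
      \<comment> \<open>Newton's inequality replaces \<open>s_j s_(j+2)\<close> by
        \<open>s_(j+1)^2\<close>, after which \<open>s_(j+1)\<close> factors out and leaves the
        positive quantity of \<open>a\<close>.\<close>
      have "0 < ?s j * (?s (Suc (Suc j)) + x * ?s (Suc j))"
        using pos b by simp
      also have "\<dots> \<le> ?s (Suc j) * (?s (Suc j) + x * ?s j)"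
        using newton by (simp add: algebra_simps power2_eq_square)
      also have "\<dots> \<le> 0"
        using neg a by (intro mult_nonpos_nonneg) auto
      finally show False by simp
    qed
  qed
  then show ?thesis unfolding Gamma_mset_def by blast
qed

subsection \<open>The spectral theorem for real symmetric matrices\<close>

text \<open>A complex eigenvalue \<open>z\<close> exists; moving the real symmetric matrix across
  the Hermitian product of an eigenvector with itself gives \<open>z = cnj z\<close>.\<close>

lemma symmetric_has_real_eigenvalue:
  fixes A :: "real mat"
  assumes A: "A \<in> carrier_mat n n" and sym: "transpose_mat A = A" and n: "0 < n"
  obtains e where "eigenvalue A e"
proof -
  define B where "B = map_mat complex_of_real A"
  have B: "B \<in> carrier_mat n n" using A by (simp add: B_def)
  have BT: "transpose_mat B = B"
    unfolding B_def by (subst map_mat_transpose) (simp add: sym)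
  obtain z v where "eigenvector B v z"
    using spectrum_non_empty[OF B n] unfolding spectrum_def eigenvalue_def by auto
  then have v: "v \<in> carrier_vec n" "v \<noteq> 0\<^sub>v n" "B *\<^sub>v v = z \<cdot>\<^sub>v v"
    using B unfolding eigenvector_def by auto
  have conj: "B *\<^sub>v conjugate v = conjugate (B *\<^sub>v v)"
    using A v(1) by (intro eq_vecI) (auto simp: B_def scalar_prod_def)
  have "z * (v \<bullet>c v) = (transpose_mat B *\<^sub>v v) \<bullet>c v"
    using v by (simp add: BT)
  also have "\<dots> = v \<bullet> (B *\<^sub>v conjugate v)"
    using B v(1) by (intro transpose_vec_mult_scalar) auto
  also have "\<dots> = cnj z * (v \<bullet>c v)"
    unfolding conj v(3) using v(1) by (simp add: conjugate_smult_vec)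
  finally have "z = cnj z"
    using v conjugate_square_eq_0_vec[OF v(1)] by simp
  then have z: "z = of_real (Re z)"
    by (simp add: complex_eq_iff)
  have "eigenvalue B z" using \<open>eigenvector B v z\<close> unfolding eigenvalue_def by blast
  then have "poly (char_poly B) z = 0"
    using eigenvalue_root_char_poly[OF B] by simp
  then have "poly (map_poly of_real (char_poly A)) (complex_of_real (Re z)) = 0"
    using of_real_hom.char_poly_hom[OF A, where 'a = complex] z unfolding B_def by simp
  then have "poly (char_poly A) (Re z) = 0" by simp
  then show ?thesis
    using that eigenvalue_root_char_poly[OF A] by blast
qed

text \<open>Complete \<open>v\<close> to a basis and apply Gram-Schmidt, which keeps the first
  vector; \<open>c\<close> is the factor that normalises it.\<close>

lemma orthogonal_matrix_with_first_column:
  fixes v :: "real vec"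
  assumes v: "v \<in> carrier_vec n" "v \<noteq> 0\<^sub>v n" and n: "0 < n"
  obtains W c where "W \<in> carrier_mat n n" "transpose_mat W * W = 1\<^sub>m n" "col W 0 = c \<cdot>\<^sub>v v"
proof -
  interpret cof_vec_space n "TYPE(real)" .
  define b where "b = basis_completion v"
  define ws where "ws = gram_schmidt n b"
  from basis_completion[OF v, folded b_def]
  have b: "distinct b" "\<not> lin_dep (set b)" "set b \<subseteq> carrier_vec n" "hd b = v" "length b = n"
    by auto
  obtain vs where "b = v # vs" using b(4,5) n by (cases b) auto
  then have hd: "hd ws = v" using gram_schmidt_hd[OF v(1)] unfolding ws_def by simp
  from gram_schmidt_result[OF b(3,1,2) ws_def] b(5)
  have ws: "set ws \<subseteq> carrier_vec n" "corthogonal ws" "length ws = n" by auto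
  have wsc: "ws ! i \<in> carrier_vec n" if "i < n" for i
    using ws(1,3) that by auto
  define nrm where "nrm i = sqrt (ws ! i \<bullet> ws ! i)" for i
  define W where "W = mat n n (\<lambda>(i, j). ws ! j $ i / nrm j)"
  have W: "W \<in> carrier_mat n n" by (simp add: W_def)
  have WW: "transpose_mat W * W = 1\<^sub>m n"
  proof (rule eq_matI)
    fix i j assume "i < dim_row (1\<^sub>m n :: real mat)" "j < dim_col (1\<^sub>m n :: real mat)"
    then have ij: "i < n" "j < n" by auto
    have "(transpose_mat W * W) $$ (i, j) = (ws ! i \<bullet> ws ! j) / (nrm i * nrm j)"
      using ij wsc[OF ij(1)] wsc[OF ij(2)]
      by (simp add: W_def scalar_prod_def sum_divide_distrib)
    also have "\<dots> = 1\<^sub>m n $$ (i, j)"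
    proof (cases "i = j")
      case True
      have "0 \<le> ws ! i \<bullet> ws ! i" unfolding scalar_prod_def by (intro sum_nonneg) simp
      moreover have "ws ! i \<bullet> ws ! i \<noteq> 0"
        using corthogonalD[OF ws(2), of i i] ws(3) ij by simp
      ultimately show ?thesis using True ij by (simp add: nrm_def)
    next
      case False
      then have "ws ! i \<bullet> ws ! j = 0"
        using corthogonalD[OF ws(2), of i j] ws(3) ij by simp
      then show ?thesis using False ij by simp
    qed
    finally show "(transpose_mat W * W) $$ (i, j) = 1\<^sub>m n $$ (i, j)" .
  qed (simp_all add: W_def)
  have "ws ! 0 = v" using hd ws(3) n by (cases ws) auto
  then have "col W 0 = (1 / nrm 0) \<cdot>\<^sub>v v"
    using v(1) n by (intro eq_vecI) (auto simp: W_def)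
  with W WW show ?thesis using that by blast
qed

lemma symmetric_orthogonal_conj:
  fixes A :: "real mat"
  assumes "A \<in> carrier_mat n n" "W \<in> carrier_mat n m" "transpose_mat A = A"
  shows "transpose_mat (transpose_mat W * (A * W)) = transpose_mat W * (A * W)"
proof -
  have "transpose_mat W \<in> carrier_mat m n" "A * W \<in> carrier_mat n m"
    using assms by simp_all
  then have "transpose_mat (transpose_mat W * (A * W)) = transpose_mat (A * W) * W"
    by (simp add: transpose_mult)
  also have "transpose_mat (A * W) = transpose_mat W * A"
    using transpose_mult[OF assms(1,2)] assms(3) by simp
  finally show ?thesis
    using assms by (simp add: assoc_mult_mat[of _ m n _ n _ m])
qed

lemma mat_delete_0_0_index:
  assumes "A \<in> carrier_mat (Suc n) (Suc n)" "i < n" "j < n"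
  shows "mat_delete A 0 0 $$ (i, j) = A $$ (Suc i, Suc j)"
  using assms by (simp add: mat_delete_def)

lemma symmetric_mat_index:
  assumes "transpose_mat A = A" "A \<in> carrier_mat n n" "i < n" "j < n"
  shows "A $$ (i, j) = A $$ (j, i)"
  using assms by (metis carrier_matD index_transpose_mat(1))

lemma symmetric_mat_delete:
  fixes A :: "'a mat"
  assumes A: "A \<in> carrier_mat (Suc n) (Suc n)" and sym: "transpose_mat A = A"
  shows "mat_delete A 0 0 \<in> carrier_mat n n" "transpose_mat (mat_delete A 0 0) = mat_delete A 0 0"
proof -
  show D: "mat_delete A 0 0 \<in> carrier_mat n n"
    using mat_delete_carrier[OF A] by simp
  show "transpose_mat (mat_delete A 0 0) = mat_delete A 0 0"
    by (rule eq_matI)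
       (use A D in \<open>auto simp: mat_delete_0_0_index[OF A] intro: symmetric_mat_index[OF sym A]\<close>)
qed

text \<open>Deflation: conjugating by an orthogonal matrix whose first column is an eigenvector
  splits off a 1 x 1 block, and the induction hypothesis diagonalises the rest.\<close>

theorem symmetric_orthogonal_diagonalization:
  fixes A :: "real mat"
  assumes "A \<in> carrier_mat n n" "transpose_mat A = A"
  shows "\<exists>U l. U \<in> carrier_mat n n \<and> transpose_mat U * U = 1\<^sub>m n
    \<and> A = U * (mat_diag n l * transpose_mat U)"
  using assms
proof (induction n arbitrary: A)
  case 0
  then have "A = 1\<^sub>m 0 * (mat_diag 0 l * transpose_mat (1\<^sub>m 0))" for l :: "nat \<Rightarrow> real"
    by (intro eq_matI) auto
  then show ?case
    by (intro exI[of _ "1\<^sub>m 0"]) auto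
next
  case (Suc m)
  let ?n = "Suc m"
  note A = Suc.prems(1) and sym = Suc.prems(2)
  obtain e v where "eigenvector A v e"
    using symmetric_has_real_eigenvalue[OF A sym] unfolding eigenvalue_def by blast
  then have v: "v \<in> carrier_vec ?n" "v \<noteq> 0\<^sub>v ?n" "A *\<^sub>v v = e \<cdot>\<^sub>v v"
    using A unfolding eigenvector_def by auto
  obtain W c where W: "W \<in> carrier_mat ?n ?n" and WW: "transpose_mat W * W = 1\<^sub>m ?n"
    and col: "col W 0 = c \<cdot>\<^sub>v v"
    using orthogonal_matrix_with_first_column[OF v(1,2)] by auto
  have WT: "transpose_mat W \<in> carrier_mat ?n ?n" using W by simp
  have WW': "W * transpose_mat W = 1\<^sub>m ?n"
    using mat_mult_left_right_inverse[OF WT W WW] .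
  define A' where "A' = transpose_mat W * (A * W)"
  have A': "A' \<in> carrier_mat ?n ?n" unfolding A'_def using W A by simp
  have sym': "transpose_mat A' = A'"
    unfolding A'_def by (rule symmetric_orthogonal_conj[OF A W sym])
  \<comment> \<open>The first column of \<open>W\<close> is an eigenvector of \<open>A\<close>, so
    the first column of \<open>A'\<close> is \<open>e\<close> times a unit vector; symmetry then
    clears the first row.\<close>
  have "A *\<^sub>v col W 0 = e \<cdot>\<^sub>v col W 0"
    unfolding col using v mult_mat_vec[OF A v(1), of c] by (simp add: smult_smult_assoc mult.commute)
  then have "col A' 0 = transpose_mat W *\<^sub>v (e \<cdot>\<^sub>v col W 0)"
    unfolding A'_def using col_mult2[OF WT mult_carrier_mat[OF A W], of 0] col_mult2[OF A W, of 0] by simp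
  also have "\<dots> = e \<cdot>\<^sub>v (transpose_mat W *\<^sub>v col W 0)"
    using col v(1) by (intro mult_mat_vec[OF WT]) simp
  also have "transpose_mat W *\<^sub>v col W 0 = col (transpose_mat W * W) 0"
    using col_mult2[OF WT W, of 0] by simp
  also have "\<dots> = unit_vec ?n 0" unfolding WW by simp
  finally have col': "A' $$ (i, 0) = (if i = 0 then e else 0)" if "i < ?n" for i
    using A' that by (metis (no_types, lifting) carrier_matD index_col index_smult_vec(1) index_unit_vec(1,3) mult_cancel_left1 mult_zero_right zero_less_Suc)
  have row': "A' $$ (0, i) = (if i = 0 then e else 0)" if "i < ?n" for i
    using col'[OF that] symmetric_mat_index[OF sym' A' that, of 0] by simp
  let ?C = "mat_delete A' 0 0"
  note C = symmetric_mat_delete[OF A' sym']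
  obtain U l where U: "U \<in> carrier_mat m m" and UU: "transpose_mat U * U = 1\<^sub>m m"
    and CU: "?C = U * (mat_diag m l * transpose_mat U)"
    using Suc.IH[OF C] by blast
  \<comment> \<open>The eigenvalue split off takes index 0 and those of the smaller block move up by
    one.\<close>
  define L where "L = case_nat e l"
  let ?block = "\<lambda>a B. four_block_mat (mat 1 1 (\<lambda>_. a)) (0\<^sub>m 1 m) (0\<^sub>m m 1) B"
  have block_mult: "?block a B * ?block a' B' = ?block (a * a') (B * B')"
    if "B \<in> carrier_mat m m" "B' \<in> carrier_mat m m" for a a' and B B' :: "real mat"
  proof -
    have "mat 1 1 (\<lambda>_. a) * mat 1 1 (\<lambda>_. a') = mat 1 1 (\<lambda>_. a * a')"
      by (rule eq_matI) (auto simp: scalar_prod_def)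
    then show ?thesis
      using that by (subst mult_four_block_mat[of _ 1 1 _ m _ m _ _ 1 _ m]) auto
  qed
  have block_transpose: "transpose_mat (?block a B) = ?block a (transpose_mat B)"
    if "B \<in> carrier_mat m m" for a and B :: "real mat"
    by (rule eq_matI) (use that in auto)
  have block_1: "?block 1 (1\<^sub>m m) = 1\<^sub>m ?n"
    by (rule eq_matI) auto
  have block_diag: "?block e (mat_diag m l) = mat_diag ?n L"
    by (rule eq_matI) (auto simp: mat_diag_def L_def split: nat.split)
  have block_A': "A' = ?block e ?C"
    by (rule eq_matI)
       (use A' C col' row' in \<open>auto simp: mat_delete_0_0_index[OF A'] Suc_diff_Suc\<close>)
  have diag: "mat_diag m l \<in> carrier_mat m m" by simp
  define V where "V = ?block 1 U"
  have V: "V \<in> carrier_mat ?n ?n" using U by (intro carrier_matI) (simp_all add: V_def)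
  have VT: "transpose_mat V = ?block 1 (transpose_mat U)"
    unfolding V_def by (rule block_transpose[OF U])
  have VV: "transpose_mat V * V = 1\<^sub>m ?n"
    unfolding VT unfolding V_def using block_mult[of "transpose_mat U" U 1 1] U UU block_1 by simp
  have "mat_diag ?n L * transpose_mat V = ?block e (mat_diag m l * transpose_mat U)"
    unfolding VT block_diag[symmetric] using block_mult[of "mat_diag m l" "transpose_mat U" e 1] U by simp
  then have "V * (mat_diag ?n L * transpose_mat V) = ?block e (U * (mat_diag m l * transpose_mat U))"
    unfolding V_def using block_mult[of U "mat_diag m l * transpose_mat U" 1 e] U
    by (simp add: mult_carrier_mat[OF diag])
  then have A'V: "A' = V * (mat_diag ?n L * transpose_mat V)"
    using block_A' CU by simp
  let ?L = "mat_diag ?n L"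
  have L: "?L \<in> carrier_mat ?n ?n" by simp
  have VT': "transpose_mat V \<in> carrier_mat ?n ?n" using V by simp
  have WVT: "transpose_mat (W * V) = transpose_mat V * transpose_mat W"
    using W V by (rule transpose_mult)
  have "transpose_mat (W * V) * (W * V) = transpose_mat V * ((transpose_mat W * W) * V)"
    unfolding WVT using W V WT VT' by (simp add: assoc_mult_mat[of _ ?n ?n _ ?n _ ?n])
  also have "\<dots> = 1\<^sub>m ?n" unfolding WW using V VV by simp
  finally have 1: "transpose_mat (W * V) * (W * V) = 1\<^sub>m ?n" .
  have "A = (W * transpose_mat W) * (A * (W * transpose_mat W))"
    unfolding WW' using A by simp
  also have "\<dots> = W * (A' * transpose_mat W)"
    unfolding A'_def using W A WT by (simp add: assoc_mult_mat[of _ ?n ?n _ ?n _ ?n])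
  also have "\<dots> = (W * V) * (?L * transpose_mat (W * V))"
    unfolding A'V WVT using W V WT VT' L by (simp add: assoc_mult_mat[of _ ?n ?n _ ?n _ ?n] del: mat_diag_dim)
  finally show ?case using 1 W V by (intro exI[of _ "W * V"] exI[of _ L]) simp
qed

subsection \<open>Resolvents and deleted eigenvalues\<close>

abbreviation spectrum_mset :: "real mat \<Rightarrow> real multiset" where
  "spectrum_mset A \<equiv> proots (char_poly A)"

text \<open>Numerators of resolvent forms \<open>v . (1 + t A)^(-1) v\<close> lie here: in an
  eigenbasis each summand loses one factor of \<open>det (1 + t A)\<close>. Indexing by
  \<open>I\<close> rather than by values lets repeated eigenvalues carry separate weights.\<close>

definition removal_cone :: "real multiset \<Rightarrow> real poly set" where
  "removal_cone M = {R. \<exists>I w f. finite (I :: nat set) \<and> (\<forall>i\<in>I. 0 \<le> w i \<and> f i \<in># M)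
     \<and> R = (\<Sum>i\<in>I. Polynomial.smult (w i) (esym_poly (M - {#f i#})))}"

text \<open>Each summand times \<open>esym_poly D\<close> belongs to \<open>M + D\<close> with one
  entry deleted, which \<open>Gamma_mset_remove\<close> places one level lower. As every
  \<open>esym_poly\<close> has constant coefficient 1, \<open>coeff R 0\<close> is the total weight,
  and its positivity forces a positive weight.\<close>

lemma removal_cone_coeffs:
  assumes "Gamma_mset (Suc k) (M + D)" "R \<in> removal_cone M" "j \<le> k"
  shows "0 \<le> coeff (R * esym_poly D) j" "0 < coeff R 0 \<Longrightarrow> 0 < coeff (R * esym_poly D) j"
proof -
  obtain I :: "nat set" and w f where I: "finite I" and w: "\<And>i. i \<in> I \<Longrightarrow> 0 \<le> w i"
    and f: "\<And>i. i \<in> I \<Longrightarrow> f i \<in># M"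
    and R: "R = (\<Sum>i\<in>I. Polynomial.smult (w i) (esym_poly (M - {#f i#})))"
    using assms(2) unfolding removal_cone_def by blast
  have E: "0 < coeff (esym_poly (M - {#f i#} + D)) j" if "i \<in> I" for i
  proof -
    have "M + D = add_mset (f i) (M - {#f i#} + D)" using f[OF that] by simp
    then have "Gamma_mset k (M - {#f i#} + D)" using assms(1) Gamma_mset_remove by metis
    then show ?thesis using assms(3) unfolding Gamma_mset_def by blast
  qed
  have coeff: "coeff (R * esym_poly D) j = (\<Sum>i\<in>I. w i * coeff (esym_poly (M - {#f i#} + D)) j)"
    by (simp add: R sum_distrib_right coeff_sum)
  show "0 \<le> coeff (R * esym_poly D) j"
    unfolding coeff using w E by (intro sum_nonneg mult_nonneg_nonneg) (auto intro: less_imp_le)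
  assume "0 < coeff R 0"
  then have "0 < (\<Sum>i\<in>I. w i)" by (simp add: R coeff_sum)
  then obtain i where i: "i \<in> I" "0 < w i"
    by (metis less_eq_real_def sum_nonpos w leD)
  show "0 < coeff (R * esym_poly D) j"
    unfolding coeff using I i w E
    by (intro sum_pos2[OF I i(1)] mult_pos_pos mult_nonneg_nonneg) (auto intro: less_imp_le)
qed

lemma proots_prod_list_linear: "proots (\<Prod>a\<leftarrow>xs. [:- a, 1:]) = mset (xs :: real list)"
proof (induction xs)
  case (Cons x xs)
  have "(\<Prod>a\<leftarrow>xs. [:- a, 1:]) \<noteq> (0 :: real poly)" by (auto simp: prod_list_zero_iff)
  then show ?case using Cons proots_mult[of "[:-x, 1:]" "\<Prod>a\<leftarrow>xs. [:- a, 1:]"]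
    by (simp del: mult_pCons_left)
qed simp

lemma spectrum_mset_upper_triangular:
  assumes "A \<in> carrier_mat n n" "upper_triangular A"
  shows "spectrum_mset A = mset (diag_mat A)"
  using char_poly_upper_triangular[OF assms] proots_prod_list_linear by simp

lemma poly_esym_poly_mset_map:
  assumes "finite I"
  shows "poly (esym_poly (image_mset f (mset_set I))) t = (\<Prod>i\<in>I. 1 + t * f i)"
  using assms by (induction I) (simp_all add: algebra_simps)

text \<open>The product \<open>d * (p - q)\<close> vanishes everywhere. This lets resolvent
  identities be checked only at those \<open>t\<close> where the matrix is invertible.\<close>

lemma poly_eq_off_zeros:
  fixes p q d :: "real poly"
  assumes "\<And>t. poly d t \<noteq> 0 \<Longrightarrow> poly p t = poly q t" "d \<noteq> 0"
  shows "p = q"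
proof -
  have "poly (d * (p - q)) t = 0" for t using assms(1)[of t] by auto
  then have "d * (p - q) = 0" using poly_all_0_iff_0 by blast
  then show ?thesis using assms(2) by simp
qed

lemma esym_poly_nonzero: "esym_poly M \<noteq> 0"
  using coeff_0_esym_poly[of M] by force

text \<open>In an orthonormal eigenbasis \<open>1 + t A\<close> is diagonal with entries
  \<open>1 + t l i\<close>, which gives the determinant and decouples the linear system. The
  solution \<open>x\<close> stands in for the inverse applied to \<open>v\<close>, and one
  \<open>R\<close> serves all \<open>t\<close>.\<close>

lemma symmetric_resolvent:
  fixes A :: "real mat"
  assumes A: "A \<in> carrier_mat n n" and sym: "transpose_mat A = A"
  shows "size (spectrum_mset A) = n"
    and "det (1\<^sub>m n + t \<cdot>\<^sub>m A) = poly (esym_poly (spectrum_mset A)) t"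
    and "v \<in> carrier_vec n \<Longrightarrow> \<exists>R\<in>removal_cone (spectrum_mset A). \<forall>t. \<forall>x\<in>carrier_vec n.
      (1\<^sub>m n + t \<cdot>\<^sub>m A) *\<^sub>v x = v \<longrightarrow> poly R t = poly (esym_poly (spectrum_mset A)) t * (v \<bullet> x)"
proof -
  obtain U l where U: "U \<in> carrier_mat n n" and UU: "transpose_mat U * U = 1\<^sub>m n"
    and AU: "A = U * (mat_diag n l * transpose_mat U)"
    using symmetric_orthogonal_diagonalization[OF A sym] by blast
  let ?T = "transpose_mat U" and ?L = "mat_diag n l" and ?M = "spectrum_mset A"
  have T: "?T \<in> carrier_mat n n" using U by simp
  have L: "?L \<in> carrier_mat n n" by simp
  have UU': "U * ?T = 1\<^sub>m n" using mat_mult_left_right_inverse[OF T U UU] .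
  have "similar_mat_wit A ?L U ?T"
    using U T L A UU UU' AU by (intro similar_mat_witI[of _ _ n]) (simp_all add: assoc_mult_mat[of _ n n _ n _ n])
  then have "char_poly A = char_poly ?L"
    using char_poly_similar unfolding similar_mat_def by blast
  also have "spectrum_mset ?L = mset (diag_mat ?L)" for L
    by (rule arg_cong, rule spectrum_mset_upper_triangular[OF L]) (auto simp: mat_diag_def intro!: upper_triangularI)
  also have "diag_mat ?L = map l [0..<n]"
    by (auto simp: diag_mat_def mat_diag_def)
  finally have M: "?M = image_mset l (mset_set {0..<n})"
    by simp
  then show "size ?M = n" by simp
  have detM: "poly (esym_poly ?M) t = (\<Prod>i = 0..<n. 1 + t * l i)" for t
    unfolding M by (rule poly_esym_poly_mset_map) simp
  let ?D = "mat_diag n (\<lambda>i. 1 + t * l i)"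
  have D: "?D \<in> carrier_mat n n" by simp
  have "1\<^sub>m n + t \<cdot>\<^sub>m ?L = ?D" by (rule eq_matI) (auto simp: mat_diag_def)
  then have "U * (?D * ?T) = U * ((1\<^sub>m n + t \<cdot>\<^sub>m ?L) * ?T)" by simp
  also have "\<dots> = 1\<^sub>m n + t \<cdot>\<^sub>m A"
    unfolding AU using U T L UU'
    by (simp add: add_mult_distrib_mat[of _ n n] mult_add_distrib_mat[of _ n n _ n]
        mult_smult_distrib[of _ n n _ n] mult_smult_assoc_mat[of _ n n _ n] del: mat_diag_dim)
  finally have "det (1\<^sub>m n + t \<cdot>\<^sub>m A) = det (U * (?D * ?T))" by simp
  also have "\<dots> = det U * (det ?D * det ?T)"
    using U T D by (simp add: det_mult[of _ n] del: mat_diag_dim)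
  also have "\<dots> = det (?T * U) * det ?D"
    using U T by (simp add: det_mult[of _ n])
  also have "\<dots> = det ?D" unfolding UU by simp
  also have "\<dots> = (\<Prod>i = 0..<n. 1 + t * l i)"
    by (subst det_upper_triangular[OF _ D]) (auto simp: prod_list_diag_prod mat_diag_def intro!: upper_triangularI)
  finally show "det (1\<^sub>m n + t \<cdot>\<^sub>m A) = poly (esym_poly ?M) t"
    unfolding detM .
  assume v: "v \<in> carrier_vec n"
  define u where "u = ?T *\<^sub>v v"
  have u: "u \<in> carrier_vec n" unfolding u_def using T v by simp
  \<comment> \<open>The weights are squared coordinates of \<open>v\<close> in the eigenbasis, hence
    nonnegative.\<close>
  define R where "R = (\<Sum>i\<in>{0..<n}. Polynomial.smult ((u $ i)\<^sup>2) (esym_poly (?M - {#l i#})))"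
  have "R \<in> removal_cone ?M"
    unfolding removal_cone_def R_def
    by (rule CollectI, rule exI[of _ "{0..<n}"], rule exI[of _ "\<lambda>i. (u $ i)\<^sup>2"], rule exI[of _ l]) (simp add: M)
  moreover have "poly R t = poly (esym_poly ?M) t * (v \<bullet> x)"
    if x: "x \<in> carrier_vec n" and eq: "(1\<^sub>m n + t \<cdot>\<^sub>m A) *\<^sub>v x = v" for t x
  proof -
    define y where "y = ?T *\<^sub>v x"
    have y: "y \<in> carrier_vec n" unfolding y_def using T x by simp
    have tx: "t \<cdot>\<^sub>m A *\<^sub>v x = t \<cdot>\<^sub>v (A *\<^sub>v x)"
      using A x by (intro eq_vecI) auto
    have "?T *\<^sub>v (A *\<^sub>v x) = (?T * U) *\<^sub>v (?L *\<^sub>v y)"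
      unfolding AU y_def using U T L x by (simp add: assoc_mult_mat_vec[of _ n n _ n] del: mat_diag_dim)
    then have TA: "?T *\<^sub>v (A *\<^sub>v x) = ?L *\<^sub>v y"
      unfolding UU using L y by (simp del: mat_diag_dim)
    have "u = ?T *\<^sub>v (x + t \<cdot>\<^sub>v (A *\<^sub>v x))"
      unfolding u_def eq[symmetric] using A x tx by (simp add: add_mult_distrib_mat_vec[of _ n n])
    also have "\<dots> = y + t \<cdot>\<^sub>v (?L *\<^sub>v y)"
      unfolding y_def[symmetric] TA[symmetric] using A x T
      by (simp add: mult_add_distrib_mat_vec[OF T] mult_mat_vec[OF T] y_def)
    finally have u_eq: "u = y + t \<cdot>\<^sub>v (?L *\<^sub>v y)" .
    have Ly: "(?L *\<^sub>v y) $ i = l i * y $ i" if "i < n" for i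
      using that y by (simp add: mat_diag_def scalar_prod_def if_distrib[of "\<lambda>z. z * _"] cong: if_cong)
    have ui: "u $ i = (1 + t * l i) * y $ i" if "i < n" for i
      using that y L Ly[OF that] unfolding u_eq by (simp add: algebra_simps del: mat_diag_dim)
    have "v \<bullet> x = v \<bullet> ((U * ?T) *\<^sub>v x)" unfolding UU' using x by simp
    also have "\<dots> = v \<bullet> (U *\<^sub>v y)"
      unfolding y_def using U T x by (simp add: assoc_mult_mat_vec[of _ n n _ n])
    also have "\<dots> = u \<bullet> y"
      unfolding u_def by (rule transpose_vec_mult_scalar[OF U y v, symmetric])
    finally have vx: "v \<bullet> x = (\<Sum>i = 0..<n. u $ i * y $ i)"
      using y by (simp add: scalar_prod_def)
    have "poly R t = (\<Sum>i = 0..<n. (u $ i)\<^sup>2 * (\<Prod>j\<in>{0..<n} - {i}. 1 + t * l j))"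
      unfolding R_def poly_sum
    proof (rule sum.cong[OF refl])
      fix i assume "i \<in> {0..<n}"
      then have "?M - {#l i#} = image_mset l (mset_set ({0..<n} - {i}))"
        unfolding M by (subst mset_set.remove[of _ i]) auto
      then show "poly (Polynomial.smult ((u $ i)\<^sup>2) (esym_poly (?M - {#l i#}))) t
          = (u $ i)\<^sup>2 * (\<Prod>j\<in>{0..<n} - {i}. 1 + t * l j)"
        by (simp add: poly_esym_poly_mset_map)
    qed
    \<comment> \<open>Writing one factor \<open>u $ i\<close> as
      \<open>(1 + t * l i) * y $ i\<close> restores the omitted factor, without any
      division.\<close>
    also have "\<dots> = (\<Sum>i = 0..<n. (\<Prod>j = 0..<n. 1 + t * l j) * (u $ i * y $ i))"
    proof (rule sum.cong[OF refl])
      fix i assume i: "i \<in> {0..<n}"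
      then have "(\<Prod>j = 0..<n. 1 + t * l j) = (1 + t * l i) * (\<Prod>j\<in>{0..<n} - {i}. 1 + t * l j)"
        by (intro prod.remove) auto
      then show "(u $ i)\<^sup>2 * (\<Prod>j\<in>{0..<n} - {i}. 1 + t * l j)
          = (\<Prod>j = 0..<n. 1 + t * l j) * (u $ i * y $ i)"
        using ui[of i] i by (simp add: power2_eq_square mult_ac)
    qed
    finally show ?thesis unfolding detM vx by (simp add: sum_distrib_left)
  qed
  ultimately show "\<exists>R\<in>removal_cone ?M. \<forall>t. \<forall>x\<in>carrier_vec n.
      (1\<^sub>m n + t \<cdot>\<^sub>m A) *\<^sub>v x = v \<longrightarrow> poly R t = poly (esym_poly ?M) t * (v \<bullet> x)"
    by blast
qed

section \<open>Cramer's rule and bordered matrices\<close>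

lemma solution_exists:
  fixes M :: "real mat"
  assumes M: "M \<in> carrier_mat n n" and "det M \<noteq> 0" and v: "v \<in> carrier_vec n"
  obtains x where "x \<in> carrier_vec n" "M *\<^sub>v x = v"
proof -
  let ?x = "(1 / det M) \<cdot>\<^sub>v (adj_mat M *\<^sub>v v)"
  have adj: "adj_mat M \<in> carrier_mat n n" using adj_mat(1)[OF M] .
  have "M *\<^sub>v ?x = (1 / det M) \<cdot>\<^sub>v ((M * adj_mat M) *\<^sub>v v)"
    using M adj v by (simp add: mult_mat_vec[OF M] assoc_mult_mat_vec[OF M adj])
  also have "\<dots> = v"
    unfolding adj_mat(2)[OF M] using assms(2) v
    by (intro eq_vecI) (auto simp: smult_smult_assoc)
  finally show ?thesis using that[of ?x] adj v by simp
qed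

text \<open>Cramer's rule replaces column 0 by a multiple of the first unit vector; expansion along
  it leaves a single minor.\<close>

lemma cramer_first_unit_vec:
  fixes M :: "real mat"
  assumes M: "M \<in> carrier_mat (Suc m) (Suc m)" and x: "x \<in> carrier_vec (Suc m)"
    and eq: "M *\<^sub>v x = c \<cdot>\<^sub>v unit_vec (Suc m) 0"
  shows "x $ 0 * det M = c * det (mat_delete M 0 0)"
proof -
  let ?R = "replace_col M (c \<cdot>\<^sub>v unit_vec (Suc m) 0) 0"
  have R: "?R \<in> carrier_mat (Suc m) (Suc m)" using M by (simp add: replace_col_def)
  have "mat_delete ?R 0 0 = mat_delete M 0 0"
    using M by (intro eq_matI) (auto simp: mat_delete_def replace_col_def)
  moreover have "det ?R = (\<Sum>i<Suc m. ?R $$ (i, 0) * cofactor ?R i 0)"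
    by (rule laplace_expansion_column[OF R]) simp
  moreover have "\<dots> = ?R $$ (0, 0) * cofactor ?R 0 0 + (\<Sum>i<m. ?R $$ (Suc i, 0) * cofactor ?R (Suc i) 0)"
    by (rule sum.lessThan_Suc_shift)
  moreover have "\<dots> = c * cofactor ?R 0 0"
    using M by (simp add: replace_col_def)
  ultimately have "det ?R = c * det (mat_delete M 0 0)"
    by (simp add: cofactor_def)
  with cramer_lemma_mat[OF M x, of 0] show ?thesis unfolding eq by simp
qed

lemma mat_delete_one_plus_smult:
  fixes A :: "real mat"
  assumes "A \<in> carrier_mat (Suc m) (Suc m)"
  shows "mat_delete (1\<^sub>m (Suc m) + t \<cdot>\<^sub>m A) 0 0 = 1\<^sub>m m + t \<cdot>\<^sub>m mat_delete A 0 0"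
  using assms by (intro eq_matI) (auto simp: mat_delete_def)

context
  fixes A C :: "real mat" and m :: nat
  assumes A: "A \<in> carrier_mat (Suc m) (Suc m)" and sym: "transpose_mat A = A"
  defines "C \<equiv> mat_delete A 0 0"
begin

lemma principal_carrier: "C \<in> carrier_mat m m" and principal_sym: "transpose_mat C = C"
  unfolding C_def by (rule symmetric_mat_delete[OF A sym])+

lemma principal_det: "det (mat_delete (1\<^sub>m (Suc m) + t \<cdot>\<^sub>m A) 0 0) = poly (esym_poly (spectrum_mset C)) t"
  unfolding mat_delete_one_plus_smult[OF A] C_def[symmetric]
  by (rule symmetric_resolvent(2)[OF principal_carrier principal_sym])

text \<open>By Cramer's rule the (0,0) entry of \<open>(1 + t A)^(-1)\<close> is
  \<open>det (1 + t C) / det (1 + t A)\<close>, so the resolvent numerator for the first unit vector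
  is the polynomial of \<open>C\<close>.\<close>

lemma esym_poly_principal_in_removal_cone:
  "esym_poly (spectrum_mset C) \<in> removal_cone (spectrum_mset A)"
proof -
  let ?e = "unit_vec (Suc m) 0 :: real vec" and ?M = "\<lambda>t. 1\<^sub>m (Suc m) + t \<cdot>\<^sub>m A"
  have M: "?M t \<in> carrier_mat (Suc m) (Suc m)" for t using A by simp
  obtain R where R: "R \<in> removal_cone (spectrum_mset A)"
    and res: "\<And>t x. x \<in> carrier_vec (Suc m) \<Longrightarrow> ?M t *\<^sub>v x = ?e
      \<Longrightarrow> poly R t = poly (esym_poly (spectrum_mset A)) t * (?e \<bullet> x)"
    using symmetric_resolvent(3)[OF A sym, of ?e] by auto
  have "R = esym_poly (spectrum_mset C)"
  proof (rule poly_eq_off_zeros[OF _ esym_poly_nonzero[of "spectrum_mset A"]])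
    fix t assume nz: "poly (esym_poly (spectrum_mset A)) t \<noteq> 0"
    note det = symmetric_resolvent(2)[OF A sym, of t]
    obtain x where x: "x \<in> carrier_vec (Suc m)" "?M t *\<^sub>v x = ?e"
      using solution_exists[OF M[of t], of ?e] nz det by auto
    have "x $ 0 * det (?M t) = 1 * det (mat_delete (?M t) 0 0)"
      by (rule cramer_first_unit_vec[OF M x(1)]) (simp add: x(2))
    with res[OF x] x(1) show "poly R t = poly (esym_poly (spectrum_mset C)) t"
      by (simp add: principal_det det mult.commute)
  qed
  with R show ?thesis by simp
qed

text \<open>Schur complement of the first diagonal entry of \<open>1 + t A\<close>.\<close>

lemma esym_poly_bordered:
  obtains R where "R \<in> removal_cone (spectrum_mset C)"
    "esym_poly (spectrum_mset A) = [:1, A $$ (0, 0):] * esym_poly (spectrum_mset C) - [:0, 0, 1:] * R"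
proof -
  let ?n = "Suc m"
  let ?M = "\<lambda>t. 1\<^sub>m ?n + t \<cdot>\<^sub>m A" and ?N = "\<lambda>t. 1\<^sub>m m + t \<cdot>\<^sub>m C"
  note C = principal_carrier principal_sym
  have M: "?M t \<in> carrier_mat ?n ?n" for t using A by simp
  have N: "?N t \<in> carrier_mat m m" for t using C by simp
  define b where "b = vec m (\<lambda>i. A $$ (Suc i, 0))"
  have b: "b \<in> carrier_vec m" by (simp add: b_def)
  obtain R where R: "R \<in> removal_cone (spectrum_mset C)"
    and res: "\<And>t x. x \<in> carrier_vec m \<Longrightarrow> ?N t *\<^sub>v x = b
      \<Longrightarrow> poly R t = poly (esym_poly (spectrum_mset C)) t * (b \<bullet> x)"
    using symmetric_resolvent(3)[OF C b] by auto
  have "esym_poly (spectrum_mset A) = [:1, A $$ (0, 0):] * esym_poly (spectrum_mset C) - [:0, 0, 1:] * R"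
  proof (rule poly_eq_off_zeros[OF _ esym_poly_nonzero[of "spectrum_mset C"]])
    fix t assume nz: "poly (esym_poly (spectrum_mset C)) t \<noteq> 0"
    note det = symmetric_resolvent(2)[OF C, of t]
    obtain x where x: "x \<in> carrier_vec m" "?N t *\<^sub>v x = b"
      using solution_exists[OF N[of t] _ b] nz det by auto
    \<comment> \<open>With this choice the rows below the first give
      \<open>t b - t (1 + t C) x = 0\<close>, and row 0 gives the Schur complement
      \<open>c\<close>.\<close>
    define X where "X = vCons 1 (- t \<cdot>\<^sub>v x)"
    have X: "X \<in> carrier_vec ?n" using x(1) by (simp add: X_def)
    define c where "c = 1 + t * A $$ (0, 0) - t\<^sup>2 * (b \<bullet> x)"
    have MX: "?M t *\<^sub>v X = c \<cdot>\<^sub>v unit_vec ?n 0"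
    proof (rule eq_vecI)
      fix i assume "i < dim_vec (c \<cdot>\<^sub>v unit_vec ?n 0)"
      then have i: "i < ?n" by simp
      have "(?M t *\<^sub>v X) $ i = (\<Sum>j<?n. ?M t $$ (i, j) * X $ j)"
        using i X A by (auto simp: scalar_prod_def atLeast0LessThan simp del: sum.lessThan_Suc intro!: sum.cong)
      also have "\<dots> = ?M t $$ (i, 0) - t * (\<Sum>j<m. ?M t $$ (i, Suc j) * x $ j)"
        using x(1) unfolding sum.lessThan_Suc_shift
        by (simp add: X_def sum_distrib_left sum_negf[symmetric] mult_ac del: index_add_mat)
      also have "\<dots> = (c \<cdot>\<^sub>v unit_vec ?n 0) $ i"
      proof (cases i)
        case 0
        have "(\<Sum>j<m. ?M t $$ (0, Suc j) * x $ j) = t * (b \<bullet> x)"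
          using A x(1) symmetric_mat_index[OF sym A, of 0]
          by (simp add: b_def scalar_prod_def sum_distrib_left atLeast0LessThan mult_ac)
        then show ?thesis
          using A 0 by (simp add: c_def power2_eq_square)
      next
        case (Suc k)
        then have k: "k < m" using i by simp
        have "(\<Sum>j<m. ?M t $$ (Suc k, Suc j) * x $ j) = (?N t *\<^sub>v x) $ k"
          using A C k x(1)
          by (auto simp: scalar_prod_def atLeast0LessThan C_def mat_delete_0_0_index[OF A] intro!: sum.cong)
        also have "\<dots> = A $$ (Suc k, 0)" unfolding x(2) using k by (simp add: b_def)
        finally show ?thesis using A Suc k by simp
      qed
      finally show "(?M t *\<^sub>v X) $ i = (c \<cdot>\<^sub>v unit_vec ?n 0) $ i" .
    qed (use A in simp)
    \<comment> \<open>Since \<open>X $ 0 = 1\<close>, Cramer's rule yields the determinant itself.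
      The product of \<open>b . x\<close> with the minor is \<open>poly R t\<close>.\<close>
    have "det (?M t) = c * poly (esym_poly (spectrum_mset C)) t"
      using cramer_first_unit_vec[OF M X MX] by (simp add: principal_det X_def)
    with res[OF x] show "poly (esym_poly (spectrum_mset A)) t
        = poly ([:1, A $$ (0, 0):] * esym_poly (spectrum_mset C) - [:0, 0, 1:] * R) t"
      using symmetric_resolvent(2)[OF A sym, of t]
      by (simp add: c_def power2_eq_square algebra_simps)
  qed
  with R show ?thesis using that by blast
qed

end

subsection \<open>Comparison with the diagonal\<close>

lemma diag_mat_mat_delete:
  assumes "A \<in> carrier_mat (Suc m) (Suc m)"
  shows "mset (diag_mat A) = add_mset (A $$ (0, 0)) (mset (diag_mat (mat_delete A 0 0)))"
proof -
  have "map (\<lambda>i. A $$ (Suc i, Suc i)) [0..<m] = diag_mat (mat_delete A 0 0)"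
    using assms by (simp add: diag_mat_def mat_delete_0_0_index[OF assms])
  then show ?thesis
    using assms by (simp only: diag_mat_def carrier_matD(1)[OF assms] map_upt_Suc mset.simps)
qed

text \<open>\<open>D\<close> collects the diagonal entries already split off: zeroing the border of
  \<open>A\<close> turns its spectrum into that of the principal block together with the corner, and
  the corner moves into \<open>D\<close>.\<close>

theorem esym_poly_diag_ge:
  fixes A :: "real mat"
  assumes "A \<in> carrier_mat n n" "transpose_mat A = A"
    and "Gamma_mset k (spectrum_mset A + D)" "j \<le> k"
  shows "coeff (esym_poly (spectrum_mset A + D)) j \<le> coeff (esym_poly (mset (diag_mat A) + D)) j"
  using assms
proof (induction n arbitrary: A D)
  case 0
  then have "upper_triangular A" by (intro upper_triangularI) simp
  then show ?case using spectrum_mset_upper_triangular[OF 0(1)] by simp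
next
  case (Suc m)
  note A = Suc.prems(1) and sym = Suc.prems(2) and G = Suc.prems(3)
  let ?C = "mat_delete A 0 0" and ?a = "A $$ (0, 0)"
  obtain R where R: "R \<in> removal_cone (spectrum_mset ?C)"
    and eq: "esym_poly (spectrum_mset A) = [:1, ?a:] * esym_poly (spectrum_mset ?C) - [:0, 0, 1:] * R"
    using esym_poly_bordered[OF A sym] by blast
  let ?D = "add_mset ?a D"
  have eq': "esym_poly (spectrum_mset ?C + ?D) = esym_poly (spectrum_mset A + D) + [:0, 0, 1:] * (R * esym_poly D)"
  proof -
    have "S * (P * E) = (P * S - Q * R) * E + Q * (R * E)" for P Q S E :: "real poly"
      by (simp add: algebra_simps)
    then show ?thesis unfolding esym_poly_union esym_poly_add_mset eq by blast
  qed
  have nonneg: "0 \<le> coeff ([:0, 0, 1:] * (R * esym_poly D)) i" if "i \<le> k" for i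
  proof (cases "i < 2")
    case True
    then show ?thesis by (auto simp: less_2_cases_iff)
  next
    case False
    \<comment> \<open>The factor \<open>t^2\<close> shifts indices by 2, matching two deletions:
      \<open>A\<close> to its principal block lowers the level from \<open>k\<close> to
      \<open>k - 1\<close>, and the block to \<open>R\<close> lowers it to
      \<open>k - 2\<close>.\<close>
    define i' k' where "i' = i - 2" and "k' = k - 2"
    then have i': "i = Suc (Suc i')" and k': "k = Suc (Suc k')"
      using False that by auto
    have "Gamma_mset (Suc k') (spectrum_mset ?C + D)"
      unfolding Gamma_mset_def
    proof (intro allI impI)
      fix r assume "r \<le> Suc k'"
      \<comment> \<open>The strict form applies because the polynomial of the block has constant
        coefficient 1.\<close>
      then have "0 < coeff (esym_poly (spectrum_mset ?C) * esym_poly D) r"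
        using removal_cone_coeffs(2)[OF _ esym_poly_principal_in_removal_cone[OF A sym], of "Suc k'" D r] G k'
        by simp
      then show "0 < coeff (esym_poly (spectrum_mset ?C + D)) r" by simp
    qed
    then have "0 \<le> coeff (R * esym_poly D) i'"
      using removal_cone_coeffs(1)[OF _ R, of k' D i'] that i' k' by simp
    then show ?thesis by (simp add: i')
  qed
  have le: "coeff (esym_poly (spectrum_mset A + D)) i \<le> coeff (esym_poly (spectrum_mset ?C + ?D)) i" if "i \<le> k" for i
    unfolding eq' coeff_add using nonneg[OF that] by simp
  then have G': "Gamma_mset k (spectrum_mset ?C + ?D)"
    using G unfolding Gamma_mset_def by (meson less_le_trans)
  have "coeff (esym_poly (spectrum_mset A + D)) j \<le> coeff (esym_poly (spectrum_mset ?C + ?D)) j"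
    using le Suc.prems(4) .
  also have "\<dots> \<le> coeff (esym_poly (mset (diag_mat ?C) + ?D)) j"
    by (rule Suc.IH[OF symmetric_mat_delete[OF A sym] G' Suc.prems(4)])
  also have "mset (diag_mat ?C) + ?D = mset (diag_mat A) + D"
    by (simp add: diag_mat_mat_delete[OF A])
  finally show ?case .
qed

section \<open>Translation from coefficients to elementary symmetric functions\<close>

text \<open>Expanding the product picks the linear term from the factors in \<open>J\<close> and 1
  from the others, so \<open>J\<close> contributes in degree \<open>card J\<close>.\<close>

lemma coeff_prod_linear:
  assumes "finite I"
  shows "coeff (\<Prod>i\<in>I. [:1, f i:]) j = (\<Sum>J | J \<subseteq> I \<and> card J = j. \<Prod>i\<in>J. f i :: real)"
proof -
  have "(\<Prod>i\<in>I. [:1, f i:]) = (\<Prod>i\<in>I. monom (f i) 1 + 1)"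
    by (intro prod.cong refl poly_eqI) (simp add: coeff_pCons split: nat.split)
  also have "\<dots> = (\<Sum>J\<in>Pow I. \<Prod>i\<in>J. monom (f i) 1)"
    by (simp add: prod_add[OF assms])
  also have "\<dots> = (\<Sum>J\<in>Pow I. monom (\<Prod>i\<in>J. f i) (card J))"
  proof (rule sum.cong[OF refl])
    fix J assume "J \<in> Pow I"
    then have "finite J" using assms finite_subset by auto
    then show "(\<Prod>i\<in>J. monom (f i) 1) = monom (\<Prod>i\<in>J. f i) (card J)"
      by (induction J) (simp_all add: mult_monom)
  qed
  finally have "coeff (\<Prod>i\<in>I. [:1, f i:]) j = (\<Sum>J\<in>Pow I. if card J = j then \<Prod>i\<in>J. f i else 0)"
    by (simp add: coeff_sum)
  also have "\<dots> = (\<Sum>J | J \<subseteq> I \<and> card J = j. \<Prod>i\<in>J. f i)"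
    using assms by (intro sum.mono_neutral_cong_right) auto
  finally show ?thesis .
qed

lemma esym_poly_mset: "esym_poly (mset xs) = (\<Prod>x\<leftarrow>xs. [:1, x:])"
  by (induction xs) simp_all

lemma elem_sym_eq_coeff: "elem_sym j v = coeff (esym_poly (mset (list_of_vec v))) j"
proof -
  have "esym_poly (mset (list_of_vec v)) = (\<Prod>i = 0..<dim_vec v. [:1, v $ i:])"
    unfolding esym_poly_mset by (subst prod.list_conv_set_nth) (simp add: list_of_vec_index)
  then show ?thesis by (simp add: coeff_prod_linear elem_sym_def)
qed

lemma Gamma_cone_iff: "v \<in> Gamma_cone k n \<longleftrightarrow> v \<in> carrier_vec n \<and> Gamma_mset k (mset (list_of_vec v))"
proof -
  have "{..k} = insert 0 {1..k}" by auto
  then have "Gamma_mset k (mset (list_of_vec v)) \<longleftrightarrow> (\<forall>j\<in>{1..k}. 0 < coeff (esym_poly (mset (list_of_vec v))) j)"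
    unfolding Gamma_mset_def atMost_iff[symmetric] Ball_def[symmetric] by simp
  then show ?thesis
    unfolding Gamma_cone_def elem_sym_eq_coeff by blast
qed

lemma mset_eigenvalue_vec: "mset (list_of_vec (eigenvalue_vec A)) = spectrum_mset A"
  by (simp add: eigenvalue_vec_def list_vec)

lemma dim_eigenvalue_vec: "dim_vec (eigenvalue_vec A) = size (spectrum_mset A)"
  using arg_cong[OF mset_eigenvalue_vec[of A], of size] by simp

text \<open>The dimension condition inside \<open>Gamma_cone\<close> holds because a symmetric
  matrix has \<open>n\<close> real eigenvalues with multiplicity.\<close>

lemma k_positive_iff:
  "k_positive k n A \<longleftrightarrow> A \<in> carrier_mat n n \<and> transpose_mat A = A \<and> Gamma_mset k (spectrum_mset A)"
proof -
  have "eigenvalue_vec A \<in> carrier_vec n" if "A \<in> carrier_mat n n" "transpose_mat A = A"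
    by (rule carrier_vecI, rule trans[OF dim_eigenvalue_vec symmetric_resolvent(1)[OF that]])
  then show ?thesis
    unfolding k_positive_def Gamma_cone_iff mset_eigenvalue_vec by argo
qed

theorem corollary1p4:
  fixes n k :: nat and A :: "real mat"
  assumes "n \<ge> 2" and "n \<ge> k" and "k \<ge> 1"
    and "A \<in> carrier_mat n n"
    and "k_positive k n A"
  shows "k_positive k n (diag_part A)
    \<and> vec n (\<lambda>i. A $$ (i, i)) \<in> Gamma_cone k n
    \<and> mat_elem_sym k (diag_part A) \<ge> mat_elem_sym k A"
proof -
  have A: "A \<in> carrier_mat n n" "transpose_mat A = A" "Gamma_mset k (spectrum_mset A)"
    using assms(5) unfolding k_positive_iff by auto
  have le: "coeff (esym_poly (spectrum_mset A)) j \<le> coeff (esym_poly (mset (diag_mat A))) j" if "j \<le> k" for j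
    using esym_poly_diag_ge[OF A(1,2), of k "{#}" j] A(3) that by simp
  \<comment> \<open>The comparison holds at every index up to \<open>k\<close>, so positivity passes
    from the spectrum to the diagonal.\<close>
  then have G: "Gamma_mset k (mset (diag_mat A))"
    using A(3) unfolding Gamma_mset_def by (meson less_le_trans)
  have D: "diag_part A \<in> carrier_mat n n" "transpose_mat (diag_part A) = diag_part A"
    and "upper_triangular (diag_part A)" and "diag_mat (diag_part A) = diag_mat A"
    using A(1) by (auto simp: diag_part_def mat_diag_def diag_mat_def)
  then have spec: "spectrum_mset (diag_part A) = mset (diag_mat A)"
    using spectrum_mset_upper_triangular[OF D(1)] by simp
  have "list_of_vec (vec n (\<lambda>i. A $$ (i, i))) = diag_mat A"
    using A(1) by (simp add: list_of_vec_vec diag_mat_def)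
  then have "vec n (\<lambda>i. A $$ (i, i)) \<in> Gamma_cone k n"
    using G by (simp add: Gamma_cone_iff)
  moreover have "k_positive k n (diag_part A)"
    unfolding k_positive_iff spec using D G by simp
  moreover have "mat_elem_sym k A \<le> mat_elem_sym k (diag_part A)"
    unfolding mat_elem_sym_def elem_sym_eq_coeff mset_eigenvalue_vec spec using le by simp
  ultimately show ?thesis by blast
qed

end
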